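(* Let $K_{m,n}$ denote the complete bipartite graph with classes of sizes $m$ and $n$. (a) $crx_1(K_{m,n})=4$ for $2\le m\le n$. (b)(i) $crx_2(K_{2,n})=2n$ for $n\ge 2$. (b)(ii) For $n\ge 36$, $crx_2(K_{3,n})=r$, where $r$ is the integer with $\binom{r-1}{3}<n\le\binom{r}{3}$. Consequently $crx_2(K_{3,n})=\sqrt[3]{6n}+C_n$ with $1<C_n<3$. (b)(iii) $crx_2(K_{m,n})=8$ for $m\ge 4$ and $n>7^m$. (c) Let $k\ge 2$. (i) $\lceil n/(k-1)\rceil\le crx_k(K_{k,n})\le kn$ for $n\ge k$. (ii) $crx_k(K_{m,n})\ge 4k$ for $m\ge 2k$ and $n>(k-1)(4k-1)^m$. (iii) $crx_k(K_{m,n})\le 6k$ for $3k\le m\le n$.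
   Context: An edge-coloured cycle is rainbow if its edges have distinct colours. For a graph $G$ in which any $k$ vertices lie on a common cycle, $crx_k(G)$ is the minimum number of colours in an edge-colouring of $G$ such that every set of $k$ vertices of $G$ lies in some rainbow cycle. *)

theory Defs
  imports Complex_Main
begin

definition is_cycle :: "'a set set \<Rightarrow> 'a list \<Rightarrow> bool" where
  "is_cycle E vs \<longleftrightarrow> length vs \<ge> 3 \<and> distinct vs \<and>
     (\<forall>i<length vs. {vs ! i, vs ! ((i + 1) mod length vs)} \<in> E)"

definition cycle_edges :: "'a list \<Rightarrow> 'a set set" where
  "cycle_edges vs = {{vs ! i, vs ! ((i + 1) mod length vs)} | i. i < length vs}"

definition rainbow :: "('a set \<Rightarrow> nat) \<Rightarrow> 'a list \<Rightarrow> bool" where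
  "rainbow c vs \<longleftrightarrow> inj_on c (cycle_edges vs)"

definition good_colouring :: "'a set \<Rightarrow> 'a set set \<Rightarrow> nat \<Rightarrow> ('a set \<Rightarrow> nat) \<Rightarrow> bool" where
  "good_colouring V E k c \<longleftrightarrow>
     (\<forall>S. S \<subseteq> V \<and> card S = k \<longrightarrow>
        (\<exists>vs. is_cycle E vs \<and> S \<subseteq> set vs \<and> rainbow c vs))"

definition crx :: "nat \<Rightarrow> 'a set \<Rightarrow> 'a set set \<Rightarrow> nat" where
  "crx k V E = (LEAST r. \<exists>c. card (c ` E) = r \<and> good_colouring V E k c)"

definition KV :: "nat \<Rightarrow> nat \<Rightarrow> (nat + nat) set" where
  "KV m n = Inl ` {..<m} \<union> Inr ` {..<n}"

definition KE :: "nat \<Rightarrow> nat \<Rightarrow> (nat + nat) set set" where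
  "KE m n = {{Inl i, Inr j} | i j. i < m \<and> j < n}"

abbreviation crxK :: "nat \<Rightarrow> nat \<Rightarrow> nat \<Rightarrow> nat" where
  "crxK k m n \<equiv> crx k (KV m n) (KE m n)"

end

(*
  The upper bounds come from explicit colourings and explicit rainbow cycles.

  For the lower bounds, every vertex of a cycle meets two of its edges, and a cycle has equally
  many vertices on both sides. If k right vertices see the same colours, a rainbow cycle through them
  must use 2k different left vertices, hence at least 4k colours. In K_{3,n}, any two right vertices
  together see at least four colours, so that extending the colour sets of the right vertices to
  3-sets of colours gives distinct sets.
*)
theory Submission
  imports Defs "HOL-Library.FuncSet"
begin

subsection \<open>Alternating cycles and colour counts\<close>

text \<open>The constants measure how many spare vertices there are for completing a cycle through
  the prescribed ones without repeating a colour. In K_{3,n}, the edges chosen at the prescribed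
  vertices use at most four colours. Of seven colours at least three remain free, so if all 35 = (7
  choose 3) triples occur, some right vertex sees only free colours. The hypothesis n >= 36 forces r
  >= 8, which leaves room for these triples. With 6k colours, 2k fixed connectors on each side do
  the same job, and the cycle uses each colour exactly once. The threshold 7^m is (k-1)(4k-1)^m at k
  = 2: beyond it, fewer than 4k colours force k right vertices with the same vector of colours.
  Since \<open>crx\<close> is a \<open>LEAST\<close>, a lower bound also needs some good colouring
  to exist. Either the colouring of the matching upper bound or one that gives all edges different
  colours serves as this witness.\<close>

definition colour_by :: "(nat \<Rightarrow> nat \<Rightarrow> nat) \<Rightarrow> (nat + nat) set \<Rightarrow> nat" where
  "colour_by d e = d (THE i. Inl i \<in> e) (THE j. Inr j \<in> e)"

text \<open>Edges are unordered sets, while colourings are most easily given as matrices. The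
  definite descriptions recover row and column from the unique left and right end, whichever way the
  edge is written.\<close>

lemma colour_by_edge [simp]: "colour_by d {Inl i, Inr j} = d i j" "colour_by d {Inr j, Inl i} = d i j"
  by (simp_all add: colour_by_def)

definition alt_cycle :: "nat \<Rightarrow> (nat \<Rightarrow> nat) \<Rightarrow> (nat \<Rightarrow> nat) \<Rightarrow> (nat + nat) list" where
  "alt_cycle l f g = map (\<lambda>i. if even i then Inl (f (i div 2)) else Inr (g (i div 2))) [0..<2 * l]"

lemma doubleton_Inl_Inr_eq_iff [simp]:
  "{Inl i, Inr j} = {Inl i', Inr j'} \<longleftrightarrow> i = i' \<and> j = j'"
  by (auto simp: doubleton_eq_iff)

lemma edge_in_KE [simp]:
  "{Inl i, Inr j} \<in> KE m n \<longleftrightarrow> i < m \<and> j < n"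
  "{Inr j, Inl i} \<in> KE m n \<longleftrightarrow> i < m \<and> j < n"
proof -
  show "{Inl i, Inr j} \<in> KE m n \<longleftrightarrow> i < m \<and> j < n" for i j
    by (auto simp: KE_def)
  then show "{Inr j, Inl i} \<in> KE m n \<longleftrightarrow> i < m \<and> j < n"
    by (simp add: insert_commute)
qed

lemma KE_eq_image: "KE m n = (\<lambda>(i, j). {Inl i, Inr j}) ` ({..<m} \<times> {..<n})"
  by (auto simp: KE_def)

lemma finite_KE [simp]: "finite (KE m n)"
  by (simp add: KE_eq_image)

text \<open>Edges leaving even positions form the first family, edges leaving odd positions the
  second. Only the second contains the closing edge, hence the \<open>mod l\<close> there.\<close>

lemma alt_cycle_edges:
  "cycle_edges (alt_cycle l f g) =
     (\<lambda>p. {Inl (f p), Inr (g p)}) ` {..<l} \<union>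
     (\<lambda>p. {Inl (f (Suc p mod l)), Inr (g p)}) ` {..<l}" (is "?L = ?R")
proof -
  let ?vs = "alt_cycle l f g"
  have len: "length ?vs = 2 * l" by (simp add: alt_cycle_def)
  have ev: "{?vs ! (2 * p), ?vs ! ((2 * p + 1) mod length ?vs)} = {Inl (f p), Inr (g p)}"
    if "p < l" for p
    using that by (simp add: len) (simp add: alt_cycle_def)
  have od: "{?vs ! (2 * p + 1), ?vs ! ((2 * p + 1 + 1) mod length ?vs)}
      = {Inl (f (Suc p mod l)), Inr (g p)}" if "p < l" for p
  proof -
    have 1: "(2 * p + 1 + 1) mod length ?vs = 2 * (Suc p mod l)"
      by (simp add: len mult_mod_right)
    have "Suc p mod l < l" using that by simp
    then show ?thesis
      unfolding 1 using that by (simp add: alt_cycle_def insert_commute)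
  qed
  show ?thesis
  proof (intro equalityI subsetI)
    fix e assume "e \<in> ?L"
    then obtain i where i: "i < 2 * l" "e = {?vs ! i, ?vs ! ((i + 1) mod length ?vs)}"
      by (auto simp: cycle_edges_def len)
    then have "i div 2 < l" by simp
    moreover have "i = 2 * (i div 2) \<or> i = 2 * (i div 2) + 1" by presburger
    then have "e = {Inl (f (i div 2)), Inr (g (i div 2))} \<or>
        e = {Inl (f (Suc (i div 2) mod l)), Inr (g (i div 2))}"
    proof
      assume eq: "i = 2 * (i div 2)"
      then show ?thesis
        using i(2)[folded eq] ev[OF \<open>i div 2 < l\<close>, folded eq] by simp
    next
      assume eq: "i = 2 * (i div 2) + 1"
      then show ?thesis
        using i(2) od[OF \<open>i div 2 < l\<close>, folded eq] by simp
    qed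
    ultimately show "e \<in> ?R" by auto
  next
    fix e assume "e \<in> ?R"
    then obtain p where p: "p < l" "e = {Inl (f p), Inr (g p)} \<or> e = {Inl (f (Suc p mod l)), Inr (g p)}"
      by auto
    have mem: "{?vs ! i, ?vs ! ((i + 1) mod length ?vs)} \<in> ?L" if "i < 2 * l" for i
      using that by (auto simp: cycle_edges_def len)
    show "e \<in> ?L"
      using p(2) mem[of "2 * p"] mem[of "2 * p + 1"] p(1)
      unfolding ev[OF p(1)] od[OF p(1)] by auto
  qed
qed

lemma set_alt_cycle: "set (alt_cycle l f g) = Inl ` f ` {..<l} \<union> Inr ` g ` {..<l}"
proof (intro equalityI subsetI)
  fix v assume "v \<in> set (alt_cycle l f g)"
  then obtain i where "i < 2 * l" "v = (if even i then Inl (f (i div 2)) else Inr (g (i div 2)))"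
    by (auto simp: alt_cycle_def)
  then show "v \<in> Inl ` f ` {..<l} \<union> Inr ` g ` {..<l}" by (auto split: if_splits)
next
  fix v assume "v \<in> Inl ` f ` {..<l} \<union> Inr ` g ` {..<l}"
  then obtain p where "p < l" "v = Inl (f p) \<or> v = Inr (g p)" by auto
  then have "\<exists>i<2*l. v = (if even i then Inl (f (i div 2)) else Inr (g (i div 2)))"
    by (intro exI[of _ "if v = Inl (f p) then 2 * p else 2 * p + 1"]) auto
  then show "v \<in> set (alt_cycle l f g)" by (auto simp: alt_cycle_def)
qed

lemma is_cycle_iff_cycle_edges_subset:
  "is_cycle E vs \<longleftrightarrow> length vs \<ge> 3 \<and> distinct vs \<and> cycle_edges vs \<subseteq> E"
  by (auto simp: is_cycle_def cycle_edges_def)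

lemma is_cycle_alt_cycle:
  assumes "2 \<le> l" "inj_on f {..<l}" "inj_on g {..<l}"
    and "f ` {..<l} \<subseteq> {..<m}" "g ` {..<l} \<subseteq> {..<n}"
  shows "is_cycle (KE m n) (alt_cycle l f g)"
proof -
  have "inj_on (\<lambda>i. if even i then Inl (f (i div 2)) else Inr (g (i div 2))) {0..<2 * l}"
  proof (rule inj_onI)
    fix i j assume ij: "i \<in> {0..<2 * l}" "j \<in> {0..<2 * l}"
      and eq: "(if even i then Inl (f (i div 2)) else Inr (g (i div 2)))
        = (if even j then Inl (f (j div 2)) else Inr (g (j div 2)))"
    have "even i = even j" using eq by (auto split: if_splits)
    moreover have "i div 2 = j div 2"
      using eq ij inj_onD[OF assms(2), of "i div 2" "j div 2"]
        inj_onD[OF assms(3), of "i div 2" "j div 2"] by (auto split: if_splits)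
    ultimately show "i = j" by presburger
  qed
  then have "distinct (alt_cycle l f g)" by (simp add: alt_cycle_def distinct_map)
  moreover have "cycle_edges (alt_cycle l f g) \<subseteq> KE m n"
    unfolding alt_cycle_edges using assms(1,4,5) by (auto simp: image_subset_iff)
  ultimately show ?thesis
    using assms(1) by (simp add: is_cycle_iff_cycle_edges_subset) (simp add: alt_cycle_def)
qed

text \<open>Disjointness of the two colour ranges tells which family an edge of given colour belongs
  to, and injectivity within the family then gives its index.\<close>

lemma rainbow_alt_cycle:
  fixes d f g l
  defines "u \<equiv> \<lambda>p. d (f p) (g p)" and "v \<equiv> \<lambda>p. d (f (Suc p mod l)) (g p)"
  assumes "inj_on u {..<l}" "inj_on v {..<l}" "u ` {..<l} \<inter> v ` {..<l} = {}"
  shows "rainbow (colour_by d) (alt_cycle l f g)"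
  unfolding rainbow_def alt_cycle_edges
proof (rule inj_onI)
  fix e e'
  assume e: "e \<in> (\<lambda>p. {Inl (f p), Inr (g p)}) ` {..<l} \<union>
     (\<lambda>p. {Inl (f (Suc p mod l)), Inr (g p)}) ` {..<l}"
   and e': "e' \<in> (\<lambda>p. {Inl (f p), Inr (g p)}) ` {..<l} \<union>
     (\<lambda>p. {Inl (f (Suc p mod l)), Inr (g p)}) ` {..<l}"
   and eq: "colour_by d e = colour_by d e'"
  obtain p where p: "p < l" "e = {Inl (f p), Inr (g p)} \<and> colour_by d e = u p \<or>
      e = {Inl (f (Suc p mod l)), Inr (g p)} \<and> colour_by d e = v p"
    using e by (auto simp: u_def v_def)
  obtain q where q: "q < l" "e' = {Inl (f q), Inr (g q)} \<and> colour_by d e' = u q \<or>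
      e' = {Inl (f (Suc q mod l)), Inr (g q)} \<and> colour_by d e' = v q"
    using e' by (auto simp: u_def v_def)
  have uv: "u p \<noteq> v q" "v p \<noteq> u q" using assms(5) p(1) q(1) by auto
  have "p = q" using p q eq uv inj_onD[OF assms(3), of p q] inj_onD[OF assms(4), of p q]
    by auto
  then show "e = e'" using p(2) q(2) eq uv by auto
qed

text \<open>Interface for cycles written out explicitly: \<open>rotate1 xs\<close> pairs every right
  vertex with the left vertex after it, closing edge included, so that being rainbow becomes a
  single \<open>distinct\<close> condition on a list of colours.\<close>

lemma rainbow_cycle_lists:
  assumes "length xs = length ys" "2 \<le> length xs" "distinct xs" "distinct ys"
    and "set xs \<subseteq> {..<m}" "set ys \<subseteq> {..<n}"
    and "distinct (map2 d xs ys @ map2 d (rotate1 xs) ys)"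
    and "S \<subseteq> Inl ` set xs \<union> Inr ` set ys"
  shows "\<exists>vs. is_cycle (KE m n) vs \<and> S \<subseteq> set vs \<and> rainbow (colour_by d) vs"
proof (intro exI conjI)
  let ?l = "length xs"
  let ?vs = "alt_cycle ?l (nth xs) (nth ys)"
  have ixs: "nth xs ` {..<?l} = set xs" and iys: "nth ys ` {..<?l} = set ys"
    using assms(1) by (auto simp: in_set_conv_nth image_iff Bex_def) 
  have "xs \<noteq> []" using assms(2) by auto
  show "is_cycle (KE m n) ?vs"
    using assms ixs iys
    by (intro is_cycle_alt_cycle) (auto simp: inj_on_def nth_eq_iff_index_eq)
  show "S \<subseteq> set ?vs" using assms(8) by (simp only: set_alt_cycle ixs iys)
  have d1: "distinct (map2 d xs ys)" and d2: "distinct (map2 d (rotate1 xs) ys)"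
    and d3: "set (map2 d xs ys) \<inter> set (map2 d (rotate1 xs) ys) = {}"
    using assms(7) by auto
  have n1: "map2 d xs ys ! p = d (xs ! p) (ys ! p)" if "p < ?l" for p
    using that assms(1) by simp
  have n2: "map2 d (rotate1 xs) ys ! p = d (xs ! (Suc p mod ?l)) (ys ! p)" if "p < ?l" for p
    using that assms(1) by (simp add: nth_rotate1)
  show "rainbow (colour_by d) ?vs"
  proof (rule rainbow_alt_cycle)
    show "inj_on (\<lambda>p. d (xs ! p) (ys ! p)) {..<?l}"
      using d1 assms(1) n1 by (intro inj_onI) (metis distinct_conv_nth length_map length_zip lessThan_iff min.idem)
    show "inj_on (\<lambda>p. d (xs ! (Suc p mod ?l)) (ys ! p)) {..<?l}"
      using d2 assms(1) n2 by (intro inj_onI) (metis distinct_conv_nth length_map length_zip length_rotate1 lessThan_iff min.idem)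
    have "d (xs ! p) (ys ! p) \<in> set (map2 d xs ys)" if "p < ?l" for p
      using n1[OF that] that assms(1) by (metis length_map length_zip min.idem nth_mem)
    moreover have "d (xs ! (Suc p mod ?l)) (ys ! p) \<in> set (map2 d (rotate1 xs) ys)" if "p < ?l" for p
      using n2[OF that] that assms(1) by (metis length_map length_zip length_rotate1 min.idem nth_mem)
    ultimately have "(\<lambda>p. d (xs ! p) (ys ! p)) ` {..<?l} \<subseteq> set (map2 d xs ys)"
      "(\<lambda>p. d (xs ! (Suc p mod ?l)) (ys ! p)) ` {..<?l} \<subseteq> set (map2 d (rotate1 xs) ys)"
      by (auto simp only: image_subset_iff lessThan_iff)
    then show "(\<lambda>p. d (xs ! p) (ys ! p)) ` {..<?l} \<inter>
        (\<lambda>p. d (xs ! (Suc p mod ?l)) (ys ! p)) ` {..<?l} = {}"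
      using d3 by (metis (no_types, lifting) Int_mono subset_empty)
  qed
qed

section \<open>From colourings to bounds on \<open>crx\<close>\<close>

lemma crx_le:
  assumes "good_colouring V E k c" "card (c ` E) \<le> r"
  shows "crx k V E \<le> r"
proof -
  have "crx k V E \<le> card (c ` E)"
    unfolding crx_def using assms(1) by (intro Least_le) blast
  then show ?thesis using assms(2) by simp
qed

text \<open>The colouring \<open>c0\<close> guarantees that the \<open>LEAST\<close> is attained;
  its own number of colours is irrelevant to the bound.\<close>

lemma crx_ge:
  assumes "good_colouring V E k c0" "\<And>c. good_colouring V E k c \<Longrightarrow> r \<le> card (c ` E)"
  shows "r \<le> crx k V E"
proof -
  have "\<exists>c. card (c ` E) = crx k V E \<and> good_colouring V E k c"
    unfolding crx_def by (rule LeastI_ex) (use assms(1) in blast)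
  then show ?thesis using assms(2) by metis
qed

lemma card_colour_by_le:
  assumes "\<And>i j. i < m \<Longrightarrow> j < n \<Longrightarrow> d i j < r"
  shows "card (colour_by d ` KE m n) \<le> r"
proof -
  have "colour_by d ` KE m n \<subseteq> {..<r}" using assms by (auto simp: KE_def)
  from card_mono[OF _ this] show ?thesis by simp
qed

lemma crxK_le_colour_by:
  assumes "good_colouring (KV m n) (KE m n) k (colour_by d)"
    and "\<And>i j. i < m \<Longrightarrow> j < n \<Longrightarrow> d i j < r"
  shows "crxK k m n \<le> r"
  using crx_le[OF assms(1)] card_colour_by_le[of m n d r] assms(2) by blast

lemma split_vertex_set:
  assumes "S \<subseteq> KV m n" "card S = k"
  obtains A B where "S = Inl ` A \<union> Inr ` B" "A \<subseteq> {..<m}" "B \<subseteq> {..<n}" "card A + card B = k"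
proof
  let ?A = "{i. Inl i \<in> S}" and ?B = "{j. Inr j \<in> S}"
  show A: "?A \<subseteq> {..<m}" and B: "?B \<subseteq> {..<n}" using assms(1) by (auto simp: KV_def)
  show S: "S = Inl ` ?A \<union> Inr ` ?B"
  proof (intro equalityI subsetI)
    fix x assume "x \<in> S" then show "x \<in> Inl ` ?A \<union> Inr ` ?B" by (cases x) auto
  qed auto
  have "finite ?A" "finite ?B" using A B by (auto intro: finite_subset)
  then have "card (Inl ` ?A \<union> Inr ` ?B) = card ?A + card ?B"
    by (subst card_Un_disjoint) (auto simp: card_image)
  then show "card ?A + card ?B = k" using S assms(2) by metis
qed

lemma enumerate_superset:
  assumes "A \<subseteq> U" "card A \<le> k" "k \<le> card U" "finite U"
  obtains f :: "nat \<Rightarrow> 'a" where "inj_on f {..<k}" "A \<subseteq> f ` {..<k}" "f ` {..<k} \<subseteq> U"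
proof -
  obtain T where T: "A \<subseteq> T" "T \<subseteq> U" "card T = k"
    using exists_subset_between[OF assms(2,3,1,4)] by blast
  then have "finite T" using assms(4) finite_subset by blast
  then obtain f where "bij_betw f {0..<card T} T" using ex_bij_betw_nat_finite by blast
  then have "inj_on f {..<k}" "f ` {..<k} = T"
    using T(3) by (auto simp: bij_betw_def atLeast0LessThan)
  then show thesis using that T by blast
qed

text \<open>As j < n, quotient and remainder by n recover i and j from i * n + j, so all edges
  differ in colour and every cycle is rainbow. A set of k vertices has at most k on either side, so
  both sides can be padded to k vertices and joined to a cycle of length 2k.\<close>

lemma good_colouring_distinct_colours:
  assumes "2 \<le> k" "k \<le> m" "k \<le> n"
  shows "good_colouring (KV m n) (KE m n) k (colour_by (\<lambda>i j. i * n + j))"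
  unfolding good_colouring_def
proof (intro allI impI, elim conjE)
  fix S assume S: "S \<subseteq> KV m n" "card S = k"
  obtain A B where AB: "S = Inl ` A \<union> Inr ` B" "A \<subseteq> {..<m}" "B \<subseteq> {..<n}" "card A + card B = k"
    using split_vertex_set[OF S] by blast
  obtain f where f: "inj_on f {..<k}" "A \<subseteq> f ` {..<k}" "f ` {..<k} \<subseteq> {..<m}"
    using enumerate_superset[of A "{..<m}" k] AB assms by auto
  obtain g where g: "inj_on g {..<k}" "B \<subseteq> g ` {..<k}" "g ` {..<k} \<subseteq> {..<n}"
    using enumerate_superset[of B "{..<n}" k] AB assms by auto
  have cyc: "is_cycle (KE m n) (alt_cycle k f g)"
    using is_cycle_alt_cycle assms(1) f g by blast
  have "inj_on (colour_by (\<lambda>i j. i * n + j)) (KE m n)"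
  proof (rule inj_onI)
    fix e e' assume "e \<in> KE m n" "e' \<in> KE m n"
      and eq: "colour_by (\<lambda>i j. i * n + j) e = colour_by (\<lambda>i j. i * n + j) e'"
    then obtain i j i' j' where e: "e = {Inl i, Inr j}" "e' = {Inl i', Inr j'}" "j < n" "j' < n"
      by (auto simp: KE_def)
    then have "i * n + j = i' * n + j'" using eq by simp
    then have "(i * n + j) div n = (i' * n + j') div n" "(i * n + j) mod n = (i' * n + j') mod n" by simp_all
    then show "e = e'" using e by simp
  qed
  then have "rainbow (colour_by (\<lambda>i j. i * n + j)) (alt_cycle k f g)"
    using cyc unfolding rainbow_def is_cycle_iff_cycle_edges_subset by (meson inj_on_subset)
  moreover have "S \<subseteq> set (alt_cycle k f g)" using AB f g by (auto simp: set_alt_cycle)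
  ultimately show "\<exists>vs. is_cycle (KE m n) vs \<and> S \<subseteq> set vs \<and> rainbow (colour_by (\<lambda>i j. i * n + j)) vs"
    using cyc by blast
qed

lemma crxK_le_mult:
  assumes "2 \<le> k" "k \<le> m" "k \<le> n"
  shows "crxK k m n \<le> m * n"
proof (rule crxK_le_colour_by[OF good_colouring_distinct_colours[OF assms]])
  fix i j assume "i < m" "j < n"
  then have "i * n + j < Suc i * n" by simp
  also have "\<dots> \<le> m * n" using \<open>i < m\<close> by (intro mult_le_mono1) simp
  finally show "i * n + j < m * n" .
qed

subsection \<open>Lower bounds\<close>

lemma two_cycle_edges_at_vertex:
  assumes "is_cycle E vs" "v \<in> set vs"
  obtains a b where "a \<noteq> b" "a \<in> set vs" "b \<in> set vs"
    "{v, a} \<in> cycle_edges vs" "{v, b} \<in> cycle_edges vs"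
proof -
  let ?l = "length vs"
  have l: "3 \<le> ?l" and d: "distinct vs" using assms(1) by (auto simp: is_cycle_def)
  obtain p where p: "p < ?l" "v = vs ! p" using assms(2) by (auto simp: in_set_conv_nth)
  define q where "q = (if p = 0 then ?l - 1 else p - 1)"
  have q: "q < ?l" using p l by (auto simp: q_def)
  have q1: "(q + 1) mod ?l = p" using p l by (auto simp: q_def)
  have r: "(p + 1) mod ?l < ?l" using l by (intro mod_less_divisor) auto
  \<comment> \<open>Successor and predecessor positions differ because the length is at least
    3.\<close>
  have "(p + 1) mod ?l \<noteq> q" using p l by (auto simp: q_def mod_Suc split: if_splits)
  then have ne: "vs ! ((p + 1) mod ?l) \<noteq> vs ! q" using d q r by (simp add: nth_eq_iff_index_eq)
  have "{v, vs ! ((p + 1) mod ?l)} \<in> cycle_edges vs"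
    using p by (auto simp: cycle_edges_def)
  moreover have "{v, vs ! q} \<in> cycle_edges vs"
    unfolding cycle_edges_def p(2) mem_Collect_eq
    using q q1 by (intro exI[of _ q]) (auto simp: insert_commute)
  ultimately show thesis using that ne q r nth_mem by metis
qed

section \<open>The two sides of a cycle in the bipartite graph\<close>

definition left_part :: "(nat + nat) list \<Rightarrow> nat set" where
  "left_part vs = {i. Inl i \<in> set vs}"

definition right_part :: "(nat + nat) list \<Rightarrow> nat set" where
  "right_part vs = {j. Inr j \<in> set vs}"

lemma finite_parts [simp]: "finite (left_part vs)" "finite (right_part vs)"
proof -
  have "left_part vs = Inl -` set vs" "right_part vs = Inr -` set vs"
    by (auto simp: left_part_def right_part_def)
  then show "finite (left_part vs)" "finite (right_part vs)"
    by (auto intro!: finite_vimageI)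
qed

lemma right_vertex_edges:
  assumes "is_cycle (KE m n) vs" "j \<in> right_part vs"
  obtains a b where "a \<noteq> b" "a < m" "b < m" "j < n" "a \<in> left_part vs" "b \<in> left_part vs"
    "{Inl a, Inr j} \<in> cycle_edges vs" "{Inl b, Inr j} \<in> cycle_edges vs"
proof -
  have v: "Inr j \<in> set vs" using assms(2) by (simp add: right_part_def)
  obtain a b where ab: "a \<noteq> b" "a \<in> set vs" "b \<in> set vs"
    "{Inr j, a} \<in> cycle_edges vs" "{Inr j, b} \<in> cycle_edges vs"
    by (rule two_cycle_edges_at_vertex[OF assms(1) v])
  then have E: "{Inr j, a} \<in> KE m n" "{Inr j, b} \<in> KE m n"
    using assms(1) by (auto simp: is_cycle_iff_cycle_edges_subset)
  then obtain a' b' where "a = Inl a'" "b = Inl b'"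
    by (auto simp: KE_def doubleton_eq_iff)
  then show thesis using that[of a' b'] ab E by (auto simp: left_part_def insert_commute)
qed

lemma left_vertex_edges:
  assumes "is_cycle (KE m n) vs" "i \<in> left_part vs"
  obtains a b where "a \<noteq> b" "a < n" "b < n" "i < m" "a \<in> right_part vs" "b \<in> right_part vs"
    "{Inl i, Inr a} \<in> cycle_edges vs" "{Inl i, Inr b} \<in> cycle_edges vs"
proof -
  have v: "Inl i \<in> set vs" using assms(2) by (simp add: left_part_def)
  obtain a b where ab: "a \<noteq> b" "a \<in> set vs" "b \<in> set vs"
    "{Inl i, a} \<in> cycle_edges vs" "{Inl i, b} \<in> cycle_edges vs"
    by (rule two_cycle_edges_at_vertex[OF assms(1) v])
  then have E: "{Inl i, a} \<in> KE m n" "{Inl i, b} \<in> KE m n"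
    using assms(1) by (auto simp: is_cycle_iff_cycle_edges_subset)
  then obtain a' b' where "a = Inr a'" "b = Inr b'"
    by (auto simp: KE_def doubleton_eq_iff)
  then show thesis using that[of a' b'] ab E by (auto simp: right_part_def)
qed

lemma left_part_bound:
  assumes "is_cycle (KE m n) vs" shows "left_part vs \<subseteq> {..<m}"
  using left_vertex_edges[OF assms] by (metis lessThan_iff subsetI)

text \<open>The successor map of the cycle injects the right vertices into the left ones.\<close>
lemma card_right_part_le:
  assumes "is_cycle (KE m n) vs"
  shows "card (right_part vs) \<le> card (left_part vs)"
proof -
  let ?l = "length vs"
  have l: "3 \<le> ?l" and d: "distinct vs" using assms(1) by (auto simp: is_cycle_def)
  have edge: "{vs ! p, vs ! (Suc p mod ?l)} \<in> KE m n" if "p < ?l" for p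
    using assms that by (simp add: is_cycle_def)
  define P where "P = {p. p < ?l \<and> vs ! p \<in> range Inr}"
  define Q where "Q = {p. p < ?l \<and> vs ! p \<in> range Inl}"
  have "inj_on (\<lambda>p. Suc p mod ?l) P"
    by (rule inj_onI) (auto simp: P_def mod_Suc split: if_splits)
  moreover have "(\<lambda>p. Suc p mod ?l) ` P \<subseteq> Q"
  proof
    fix q assume "q \<in> (\<lambda>p. Suc p mod ?l) ` P"
    then obtain p j where p: "p < ?l" "vs ! p = Inr j" "q = Suc p mod ?l" by (auto simp: P_def)
    then have "{Inr j, vs ! q} \<in> KE m n" using edge[of p] by simp
    then have "vs ! q \<in> range Inl" by (auto simp: KE_def doubleton_eq_iff)
    moreover have "q < ?l" unfolding p(3) using l by (intro mod_less_divisor) linarith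
    ultimately show "q \<in> Q" by (simp add: Q_def)
  qed
  ultimately have PQ: "card P \<le> card Q" by (intro card_inj_on_le) (auto simp: Q_def)
  have inj: "inj_on (nth vs) X" if "X \<subseteq> {..<?l}" for X
    using d that by (auto simp: inj_on_def nth_eq_iff_index_eq subset_iff)
  have "Inr ` right_part vs = nth vs ` P"
    by (fastforce simp: right_part_def P_def in_set_conv_nth image_iff)
  moreover have "card (Inr ` right_part vs) = card (right_part vs)" by (simp add: card_image)
  moreover have "card (nth vs ` P) = card P" by (rule card_image[OF inj]) (auto simp: P_def)
  ultimately have "card (right_part vs) = card P" by metis
  moreover have "Inl ` left_part vs = nth vs ` Q"
    by (fastforce simp: left_part_def Q_def in_set_conv_nth image_iff)
  moreover have "card (Inl ` left_part vs) = card (left_part vs)" by (simp add: card_image)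
  moreover have "card (nth vs ` Q) = card Q" by (rule card_image[OF inj]) (auto simp: Q_def)
  ultimately show ?thesis using PQ by metis
qed

text \<open>Cycle edges are counted by their left end: each left vertex on the cycle owns at least
  two, no edge has two left ends, and on a rainbow cycle edges and colours are equinumerous.\<close>

lemma card_rainbow_colours_ge:
  assumes "is_cycle (KE m n) vs" "rainbow c vs"
  shows "2 * card (left_part vs) \<le> card (c ` KE m n)"
proof -
  have sub: "cycle_edges vs \<subseteq> KE m n" using assms(1) by (simp add: is_cycle_iff_cycle_edges_subset)
  then have fin: "finite (cycle_edges vs)" by (rule finite_subset) simp
  define X where "X i = {e \<in> cycle_edges vs. Inl i \<in> e}" for i
  have two: "2 \<le> card (X i)" if i: "i \<in> left_part vs" for i
  proof -
    obtain a b where ab: "a \<noteq> b" "{Inl i, Inr a} \<in> cycle_edges vs" "{Inl i, Inr b} \<in> cycle_edges vs"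
      using left_vertex_edges[OF assms(1) i] by metis
    then have "{{Inl i, Inr a}, {Inl i, Inr b}} \<subseteq> X i" by (auto simp: X_def)
    moreover have "finite (X i)" using fin by (simp add: X_def)
    ultimately have "card {{Inl i, Inr a}, {Inl i, Inr b}} \<le> card (X i)" by (rule card_mono[rotated])
    then show ?thesis using ab(1) by simp
  qed
  have "2 * card (left_part vs) \<le> (\<Sum>i\<in>left_part vs. card (X i))"
    using sum_mono[of "left_part vs" "\<lambda>_. 2" "\<lambda>i. card (X i)"] two by simp
  also have "\<dots> = card (\<Union>i\<in>left_part vs. X i)"
    by (subst card_UN_disjoint) (use fin sub in \<open>auto simp: X_def KE_def subset_iff\<close>)
  also have "\<dots> \<le> card (cycle_edges vs)"
    by (rule card_mono[OF fin]) (auto simp: X_def)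
  also have "\<dots> = card (c ` cycle_edges vs)"
    using assms(2) by (simp add: rainbow_def card_image)
  also have "\<dots> \<le> card (c ` KE m n)"
    using sub by (intro card_mono) auto
  finally show ?thesis .
qed

text \<open>All lower bounds test a colouring on sets of right vertices only.\<close>

lemma good_colouringE_right:
  assumes "good_colouring (KV m n) (KE m n) k c" "B \<subseteq> {..<n}" "card B = k"
  obtains vs where "is_cycle (KE m n) vs" "B \<subseteq> right_part vs" "rainbow c vs"
proof -
  have "Inr ` B \<subseteq> KV m n" "card ((Inr :: nat \<Rightarrow> nat + nat) ` B) = k"
    using assms by (auto simp: KV_def card_image)
  then obtain vs where "is_cycle (KE m n) vs" "Inr ` B \<subseteq> set vs" "rainbow c vs"
    using assms(1) unfolding good_colouring_def by blast
  then show thesis by (intro that[of vs]) (auto simp: right_part_def)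
qed

section \<open>Numbers of colours forced by good colourings\<close>

lemma card_colours_1_ge:
  assumes "good_colouring (KV m n) (KE m n) 1 c" "0 < n"
  shows "4 \<le> card (c ` KE m n)"
proof -
  obtain vs where vs: "is_cycle (KE m n) vs" "{0} \<subseteq> right_part vs" "rainbow c vs"
    using good_colouringE_right[OF assms(1), of "{0}"] assms(2) by auto
  obtain a b where "a \<noteq> b" "{a, b} \<subseteq> left_part vs"
    using right_vertex_edges[OF vs(1), of 0] vs(2) by (metis empty_subsetI insert_subset)
  then have "2 \<le> card (left_part vs)" using card_mono[of "left_part vs" "{a, b}"] by simp
  then show ?thesis using card_rainbow_colours_ge[OF vs(1,3)] by simp
qed

text \<open>With only two left vertices, a cycle through a right vertex uses both edges there. Any
  two edges therefore lie on a common rainbow cycle, so no colour can repeat.\<close>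

lemma card_colours_2_2_ge:
  assumes "good_colouring (KV 2 n) (KE 2 n) 2 c" "2 \<le> n"
  shows "2 * n \<le> card (c ` KE 2 n)"
proof -
  have "inj_on c (KE 2 n)"
  proof (rule inj_onI)
    fix e e' assume "e \<in> KE 2 n" "e' \<in> KE 2 n" and eq: "c e = c e'"
    then obtain i j i' j' where e: "e = {Inl i, Inr j}" "e' = {Inl i', Inr j'}"
      "i < 2" "i' < 2" "j < n" "j' < n" by (auto simp: KE_def)
    \<comment> \<open>A set of exactly two right vertices is needed even when both edges end at j;
      any other right vertex then fills the place.\<close>
    obtain j2 where j2: "j2 < n" "j2 \<noteq> j" "j' \<in> {j, j2}"
    proof (cases "j' = j")
      case True
      show thesis using that[of "if j = 0 then 1 else 0"] True assms(2) by (auto split: if_splits)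
    qed (use that e in auto)
    then obtain vs where vs: "is_cycle (KE 2 n) vs" "{j, j2} \<subseteq> right_part vs" "rainbow c vs"
      using good_colouringE_right[OF assms(1), of "{j, j2}"] e by auto
    have all: "{Inl x, Inr y} \<in> cycle_edges vs" if y: "y \<in> {j, j2}" and x: "x < 2" for x y
    proof -
      have "y \<in> right_part vs" using y vs(2) by auto
      then obtain a b where "a \<noteq> b" "a < 2" "b < 2"
        "{Inl a, Inr y} \<in> cycle_edges vs" "{Inl b, Inr y} \<in> cycle_edges vs"
        using right_vertex_edges[OF vs(1)] by metis
      moreover from this have "x = a \<or> x = b" using x by linarith
      ultimately show ?thesis by auto
    qed
    have "e \<in> cycle_edges vs" "e' \<in> cycle_edges vs" using all e j2 by auto
    then show "e = e'" using vs(3) eq by (auto simp: rainbow_def inj_on_def)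
  qed
  then have "card (c ` KE 2 n) = card (KE 2 n)" by (rule card_image)
  also have "\<dots> = 2 * n"
    unfolding KE_eq_image by (subst card_image) (auto simp: inj_on_def)
  finally show ?thesis by simp
qed

lemma card_colours_2_3_choose_3_ge:
  assumes "good_colouring (KV 3 n) (KE 3 n) 2 c" "2 \<le> n"
  shows "n \<le> card (c ` KE 3 n) choose 3"
proof -
  define K where "K = c ` KE 3 n"
  have finK: "finite K" by (simp add: K_def)
  define A where "A j = (\<lambda>i. c {Inl i, Inr j}) ` {..<3}" for j
  have AK: "A j \<subseteq> K" if "j < n" for j using that by (auto simp: A_def K_def)
  have A3: "card (A j) \<le> 3" for j unfolding A_def using card_image_le[of "{..<3::nat}"] by fastforce
  have four: "4 \<le> card (A j \<union> A j')" if j: "j < n" "j' < n" "j \<noteq> j'" for j j'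
  proof -
    obtain vs where vs: "is_cycle (KE 3 n) vs" "{j, j'} \<subseteq> right_part vs" "rainbow c vs"
      using good_colouringE_right[OF assms(1), of "{j, j'}"] j by auto
    obtain a b where ab: "a \<noteq> b" "a < 3" "b < 3"
        "{Inl a, Inr j} \<in> cycle_edges vs" "{Inl b, Inr j} \<in> cycle_edges vs"
      using right_vertex_edges[OF vs(1), of j] vs(2) by (metis insert_subset)
    obtain a' b' where ab': "a' \<noteq> b'" "a' < 3" "b' < 3"
        "{Inl a', Inr j'} \<in> cycle_edges vs" "{Inl b', Inr j'} \<in> cycle_edges vs"
      using right_vertex_edges[OF vs(1), of j'] vs(2) by (metis insert_subset)
    let ?F = "{{Inl a, Inr j}, {Inl b, Inr j}, {Inl a', Inr j'}, {Inl b', Inr j'}}"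
    have "card ?F = 4" using ab(1) ab'(1) j(3) by simp
    moreover have "inj_on c ?F"
      by (rule inj_on_subset[OF vs(3)[unfolded rainbow_def]]) (use ab ab' in auto)
    ultimately have "card (c ` ?F) = 4" by (simp only: card_image)
    moreover have "c ` ?F \<subseteq> A j \<union> A j'" using ab ab' by (auto simp: A_def)
    ultimately show ?thesis
      using card_mono[of "A j \<union> A j'" "c ` ?F"] by (simp add: A_def)
  qed
  \<comment> \<open>A right vertex may see fewer than three colours; enough colours must exist
    overall to enlarge its set to a triple.\<close>
  have "4 \<le> card (A 0 \<union> A 1)" using four[of 0 1] assms(2) by simp
  also have "\<dots> \<le> card K" using AK[of 0] AK[of 1] assms(2) by (intro card_mono finK) auto
  finally have K4: "4 \<le> card K" .
  have "\<exists>T. A j \<subseteq> T \<and> T \<subseteq> K \<and> card T = 3" if "j < n" for j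
    by (rule exists_subset_between[OF A3 _ AK[OF that] finK]) (use K4 in simp)
  then obtain T where T: "\<And>j. j < n \<Longrightarrow> A j \<subseteq> T j \<and> T j \<subseteq> K \<and> card (T j) = 3"
    by metis
  have "inj_on T {..<n}"
  proof (rule inj_onI, rule ccontr)
    fix j j' assume j: "j \<in> {..<n}" "j' \<in> {..<n}" "T j = T j'" "j \<noteq> j'"
    then have "A j \<union> A j' \<subseteq> T j" "finite (T j)" "card (T j) = 3"
      using T[of j] T[of j'] finK by (auto intro: finite_subset)
    then have "card (A j \<union> A j') \<le> 3" using card_mono by metis
    then show False using four[of j j'] j by simp
  qed
  moreover have "T ` {..<n} \<subseteq> {X. X \<subseteq> K \<and> card X = 3}" using T by auto
  ultimately have "card {..<n} \<le> card {X. X \<subseteq> K \<and> card X = 3}"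
    using finK by (intro card_inj_on_le) auto
  then show ?thesis using n_subsets[OF finK, of 3] by (simp add: K_def)
qed

lemma pigeonhole_fibre:
  assumes "finite X" "f ` X \<subseteq> Y" "finite Y" "(k - 1) * card Y < card X" "1 \<le> k"
  obtains B where "B \<subseteq> X" "card B = k" "\<And>x y. x \<in> B \<Longrightarrow> y \<in> B \<Longrightarrow> f x = f y"
proof -
  have "\<exists>y\<in>Y. k \<le> card {x \<in> X. f x = y}"
  proof (rule ccontr)
    assume "\<not> ?thesis"
    then have small: "card {x \<in> X. f x = y} \<le> k - 1" if "y \<in> Y" for y using that by force
    have "X = (\<Union>y\<in>Y. {x \<in> X. f x = y})" using assms(2) by auto
    then have "card X \<le> (\<Sum>y\<in>Y. card {x \<in> X. f x = y})"
      using card_UN_le[OF assms(3)] by metis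
    also have "\<dots> \<le> card Y * (k - 1)"
      using sum_mono[of Y "\<lambda>y. card {x \<in> X. f x = y}" "\<lambda>_. k - 1"] small by simp
    finally show False using assms(4) by (simp add: mult.commute)
  qed
  then obtain y where y: "k \<le> card {x \<in> X. f x = y}" by blast
  then obtain B where "B \<subseteq> {x \<in> X. f x = y}" "card B = k" by (meson obtain_subset_with_card_n)
  then show thesis using that[of B] by auto
qed

text \<open>Too few colours would give k right vertices with equally coloured edges to left vertex
  0. A cycle through them must use all k left vertices, and by balance no further right vertex. Both
  cycle edges at 0 then lead to these k vertices and have the same colour.\<close>

lemma card_colours_k_k_ge:
  assumes good: "good_colouring (KV k n) (KE k n) k c" and "2 \<le> k"
  shows "n \<le> (k - 1) * card (c ` KE k n)"
proof (rule ccontr)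
  assume "\<not> ?thesis"
  then have "(k - 1) * card (c ` KE k n) < card {..<n}" by simp
  moreover have "(\<lambda>j. c {Inl 0, Inr j}) ` {..<n} \<subseteq> c ` KE k n" using assms(2) by auto
  ultimately obtain B where B: "B \<subseteq> {..<n}" "card B = k"
    and same: "\<And>x y. x \<in> B \<Longrightarrow> y \<in> B \<Longrightarrow> c {Inl 0, Inr x} = c {Inl 0, Inr y}"
    using pigeonhole_fibre[of "{..<n}" "\<lambda>j. c {Inl 0, Inr j}" "c ` KE k n" k] assms(2) by auto
  obtain vs where vs: "is_cycle (KE k n) vs" "B \<subseteq> right_part vs" "rainbow c vs"
    using good_colouringE_right[OF good B] .
  have Rk: "k \<le> card (right_part vs)" using card_mono[OF _ vs(2)] B(2) by simp
  have RL: "card (right_part vs) \<le> card (left_part vs)" by (rule card_right_part_le[OF vs(1)])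
  have Lk: "card (left_part vs) \<le> k" using card_mono[OF _ left_part_bound[OF vs(1)]] by simp
  have "left_part vs = {..<k}"
    by (rule card_subset_eq) (use left_part_bound[OF vs(1)] Rk RL Lk in auto)
  then have "0 \<in> left_part vs" using assms(2) by simp
  moreover have "B = right_part vs"
    by (rule card_subset_eq) (use vs(2) B Rk RL Lk in auto)
  ultimately obtain a b where ab: "a \<noteq> b" "a \<in> B" "b \<in> B"
    "{Inl 0, Inr a} \<in> cycle_edges vs" "{Inl 0, Inr b} \<in> cycle_edges vs"
    using left_vertex_edges[OF vs(1), of 0] by metis
  then have "{Inl 0, Inr a} = ({Inl 0, Inr b} :: (nat + nat) set)"
    using same[of a b] vs(3) by (auto simp: rainbow_def inj_on_def)
  then show False using ab(1) by simp
qed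

text \<open>Right vertices with equal colour vectors cannot have a common neighbour on a rainbow
  cycle, since the two edges to it would agree in colour. The k pairs of neighbours are thus
  disjoint.\<close>

lemma card_colours_ge_4k:
  assumes good: "good_colouring (KV m n) (KE m n) k c" and "1 \<le> k"
    and n: "(k - 1) * (4 * k - 1) ^ m < n"
  shows "4 * k \<le> card (c ` KE m n)"
proof (rule ccontr)
  assume "\<not> ?thesis"
  then have few: "card (c ` KE m n) \<le> 4 * k - 1" by simp
  let ?Y = "Pi\<^sub>E {..<m} (\<lambda>_. c ` KE m n)"
  let ?f = "\<lambda>j. restrict (\<lambda>i. c {Inl i, Inr j}) {..<m}"
  have cardY: "card ?Y = card (c ` KE m n) ^ m" by (simp add: card_PiE)
  have "(k - 1) * card ?Y \<le> (k - 1) * (4 * k - 1) ^ m"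
    unfolding cardY using few by (intro mult_le_mono2 power_mono) auto
  then have "(k - 1) * card ?Y < card {..<n}" using n unfolding card_lessThan by (rule le_less_trans)
  moreover have "?f ` {..<n} \<subseteq> ?Y" by (auto split: if_splits)
  moreover have "finite ?Y" by (intro finite_PiE) auto
  ultimately obtain B where B: "B \<subseteq> {..<n}" "card B = k"
    and same: "\<And>x y. x \<in> B \<Longrightarrow> y \<in> B \<Longrightarrow> ?f x = ?f y"
    using pigeonhole_fibre[of "{..<n}" ?f ?Y k] assms(2) finite_lessThan by metis
  obtain vs where vs: "is_cycle (KE m n) vs" "B \<subseteq> right_part vs" "rainbow c vs"
    using good_colouringE_right[OF good B] .
  have finB: "finite B" using B(1) by (rule finite_subset) simp
  define N where "N j = {i \<in> left_part vs. {Inl i, Inr j} \<in> cycle_edges vs}" for j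
  have two: "2 \<le> card (N j)" if jB: "j \<in> B" for j
  proof -
    obtain a b where "a \<noteq> b" "{a, b} \<subseteq> N j"
      using right_vertex_edges[OF vs(1) subsetD[OF vs(2) jB]] unfolding N_def
      by (metis (mono_tags, lifting) empty_subsetI insert_subset mem_Collect_eq)
    then show ?thesis using card_mono[of "N j" "{a, b}"] by (simp add: N_def)
  qed
  have disj: "N j \<inter> N j' = {}" if j: "j \<in> B" "j' \<in> B" "j \<noteq> j'" for j j'
  proof (rule ccontr)
    assume "N j \<inter> N j' \<noteq> {}"
    then obtain i where i: "i \<in> left_part vs" "{Inl i, Inr j} \<in> cycle_edges vs" "{Inl i, Inr j'} \<in> cycle_edges vs"
      by (auto simp: N_def)
    then have "i < m" using left_part_bound[OF vs(1)] by auto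
    then have "c {Inl i, Inr j} = c {Inl i, Inr j'}"
      using fun_cong[OF same[OF j(1,2)], of i] by simp
    then have "{Inl i, Inr j} = ({Inl i, Inr j'} :: (nat + nat) set)"
      using i vs(3) by (auto simp: rainbow_def inj_on_def)
    then show False using j(3) by simp
  qed
  have "2 * k \<le> (\<Sum>j\<in>B. card (N j))"
    using sum_mono[of B "\<lambda>_. 2" "\<lambda>j. card (N j)"] two B(2) by simp
  also have "\<dots> = card (\<Union>j\<in>B. N j)"
    by (subst card_UN_disjoint) (use finB disj in \<open>auto simp: N_def\<close>)
  also have "\<dots> \<le> card (left_part vs)" by (rule card_mono) (auto simp: N_def)
  finally have "4 * k \<le> card (c ` KE m n)" using card_rainbow_colours_ge[OF vs(1,3)] by simp
  then show False using few assms(2) by simp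
qed

subsection \<open>Colourings\<close>

text \<open>The colour records in two bits whether the left end and the right end are 0. A 4-cycle
  through both vertices 0 and one other vertex on each side shows all four bit patterns.\<close>

lemma ex_good_colouring_1_4:
  assumes "2 \<le> m" "2 \<le> n"
  shows "\<exists>d. good_colouring (KV m n) (KE m n) 1 (colour_by d) \<and> (\<forall>i j. d i j < 4)"
proof (intro exI conjI allI)
  let ?d = "\<lambda>i j. (if i = 0 then 0 else 1) + (if j = 0 then 0 else 2) :: nat"
  show "?d i j < 4" for i j :: nat by simp
  show "good_colouring (KV m n) (KE m n) 1 (colour_by ?d)"
    unfolding good_colouring_def
  proof (intro allI impI, elim conjE)
    fix S assume S: "S \<subseteq> KV m n" "card S = 1"
    then obtain v where v: "S = {v}" by (auto simp: card_1_singleton_iff)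
    obtain i j where "i < m" "j < n" "i \<noteq> 0" "j \<noteq> 0" "v \<in> {Inl 0, Inr 0, Inl i, Inr j}"
    proof (cases v)
      case (Inl i)
      show thesis
        by (rule that[of "if i = 0 then 1 else i" 1]) (use Inl S v assms in \<open>auto simp: KV_def\<close>)
    next
      case (Inr j)
      show thesis
        by (rule that[of 1 "if j = 0 then 1 else j"]) (use Inr S v assms in \<open>auto simp: KV_def\<close>)
    qed
    then show "\<exists>vs. is_cycle (KE m n) vs \<and> S \<subseteq> set vs \<and> rainbow (colour_by ?d) vs"
      by (intro rainbow_cycle_lists[where xs = "[0, i]" and ys = "[0, j]"]) (auto simp: v)
  qed
qed

text \<open>A family of \<open>n\<close> triples of colours containing all triples from \<open>{..<7}\<close> always has a
  member avoiding four given colours. The edges at each right vertex receive the three colours of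
  its triple, in arbitrary order.\<close>
lemma ex_good_colouring_2_3:
  assumes "35 \<le> n" "n \<le> r choose 3" "7 \<le> r"
  shows "\<exists>d. good_colouring (KV 3 n) (KE 3 n) 2 (colour_by d) \<and> (\<forall>i<3. \<forall>j<n. d i j < r)"
proof -
  let ?T = "\<lambda>s. {X. X \<subseteq> {..<s} \<and> card X = 3} :: nat set set"
  have cT: "card (?T s) = s choose 3" for s using n_subsets[of "{..<s}" 3] by simp
  have "?T 7 \<subseteq> ?T r" using assms(3) by auto
  moreover have "card (?T 7) \<le> n" unfolding cT using assms(1) by (simp add: numeral_eq_Suc)
  moreover have "n \<le> card (?T r)" unfolding cT by (rule assms(2))
  ultimately obtain F where F: "?T 7 \<subseteq> F" "F \<subseteq> ?T r" "card F = n"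
    using exists_subset_between[of "?T 7" n "?T r"] by auto
  have "finite F" by (rule finite_subset[OF F(2)]) simp
  then obtain h where "bij_betw h {0..<n} F" using ex_bij_betw_nat_finite F(3) by metis
  then have h: "inj_on h {..<n}" "h ` {..<n} = F"
    by (simp_all add: bij_betw_def atLeast0LessThan)
  have hr: "h j \<subseteq> {..<r}" "card (h j) = 3" if "j < n" for j
    using F(2) h(2) that by auto
  have "\<exists>e. bij_betw e {0..<3::nat} (h j)" if "j < n" for j
    using ex_bij_betw_nat_finite[of "h j"] hr[OF that] finite_subset[OF hr(1)[OF that]] by auto
  then obtain e where e: "\<And>j. j < n \<Longrightarrow> bij_betw (e j) {0..<3::nat} (h j)" by metis
  define d where "d i j = e j i" for i j
  have d_inj: "d i j \<noteq> d i' j" if "i < 3" "i' < 3" "j < n" "i \<noteq> i'" for i i' j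
    using e[of j] that by (auto simp: d_def bij_betw_def inj_on_def)
  have d_img: "(\<lambda>i. d i j) ` {..<3} = h j" if "j < n" for j
    using e[OF that] by (simp add: d_def bij_betw_def atLeast0LessThan)
  have d_in: "d i j \<in> h j" if "i < 3" "j < n" for i j
    using d_img[OF that(2)] that(1) by auto
  have avoid: "\<exists>j<n. \<forall>i<3. d i j \<notin> X" if X: "finite X" "card X \<le> 4" for X
  proof -
    have "7 - card X \<le> card ({..<7} - X)" using diff_card_le_card_Diff[OF X(1), of "{..<7}"] by simp
    then have "3 \<le> card ({..<7} - X)" using X(2) by linarith
    then obtain Y where Y: "Y \<subseteq> {..<7} - X" "card Y = 3" by (meson obtain_subset_with_card_n)
    then have "Y \<in> h ` {..<n}" using F(1) h(2) by auto
    then obtain j where j: "j < n" "h j = Y" by auto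
    then have "\<forall>i<3. d i j \<notin> X" using d_in Y(1) by blast
    then show ?thesis using j(1) by blast
  qed
  let ?good = "\<lambda>S. \<exists>vs. is_cycle (KE 3 n) vs \<and> S \<subseteq> set vs \<and> rainbow (colour_by d) vs"
  \<comment> \<open>The two left vertices and j are completed to a 4-cycle by a right vertex that
    avoids both colours used at j.\<close>
  have four: "?good S"
    if "S \<subseteq> {Inl i, Inl i', Inr j}" "i < 3" "i' < 3" "i \<noteq> i'" "j < n" for S i i' j
  proof -
    let ?X = "{d i j, d i' j}"
    have "finite ?X" "card ?X \<le> 4" by (simp_all add: card_insert_if)
    from avoid[OF this] obtain j' where j': "j' < n" "\<forall>x<3. d x j' \<notin> ?X" by blast
    then have jj: "d i j' \<notin> ?X" "d i' j' \<notin> ?X" "d i j \<noteq> d i' j" "d i j' \<noteq> d i' j'"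
      using that d_inj[of i i' j] d_inj[of i i' j'] by blast+
    then have "j \<noteq> j'" by auto
    then show ?thesis
      using that j'(1) jj
      by (intro rainbow_cycle_lists[where xs = "[i, i']" and ys = "[j, j']"]) auto
  qed
  have same: "?good {Inr a, Inr b}"
    if "a < n" "b < n" "a \<noteq> b" "i < 3" "i' < 3" "i \<noteq> i'" "distinct [d i a, d i' a, d i b, d i' b]"
    for a b i i'
    using that by (intro rainbow_cycle_lists[where xs = "[i, i']" and ys = "[a, b]"]) auto
  \<comment> \<open>Here a and b have the left neighbour s in common. A right vertex j with fresh
    colours joins their other neighbours p and q, giving a 6-cycle.\<close>
  have shared: "?good {Inr a, Inr b}"
    if "a < n" "b < n" "a \<noteq> b" and s: "s < 3" "p < 3" "q < 3" "s \<noteq> p" "s \<noteq> q" "p \<noteq> q"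
      and dist: "distinct [d s a, d p a, d s b, d q b]"
    for a b s p q
  proof -
    let ?X = "{d s a, d p a, d s b, d q b}"
    have "finite ?X" "card ?X \<le> 4" by (simp_all add: card_insert_if)
    from avoid[OF this] obtain j where j: "j < n" "\<forall>i<3. d i j \<notin> ?X" by blast
    then have jp: "d p j \<notin> ?X" "d q j \<notin> ?X" "d p j \<noteq> d q j"
      using s d_inj[of p q j] by blast+
    then have "j \<noteq> a" "j \<noteq> b" by auto
    then show ?thesis
      using that j(1) jp
      by (intro rainbow_cycle_lists[where xs = "[s, q, p]" and ys = "[b, j, a]"]) auto
  qed
  have right: "?good {Inr a, Inr b}" if ab: "a < n" "b < n" "a \<noteq> b" for a b
  proof -
    \<comment> \<open>Distinct triples are incomparable, so a and b each see a colour that the other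
      does not.\<close>
    have "h a \<noteq> h b" using h(1) ab by (auto simp: inj_on_def)
    then have "\<not> h a \<subseteq> h b" "\<not> h b \<subseteq> h a"
      using hr[OF ab(1)] hr[OF ab(2)] card_subset_eq[of "h b" "h a"] card_subset_eq[of "h a" "h b"]
      by (auto intro: finite_subset)
    then obtain x y where xy: "x \<in> h a" "x \<notin> h b" "y \<in> h b" "y \<notin> h a" by blast
    from xy(1) obtain i0 where i0: "i0 < 3" "d i0 a = x"
      unfolding d_img[OF ab(1), symmetric] by auto
    from xy(3) obtain j0 where j0: "j0 < 3" "d j0 b = y"
      unfolding d_img[OF ab(2), symmetric] by auto
    have ij0: "i0 < 3" "d i0 a \<notin> h b" "j0 < 3" "d j0 b \<notin> h a" using xy i0 j0 by simp_all
    define i1 where "i1 = (if i0 = 0 then 1 else 0 :: nat)"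
    have i1: "i1 < 3" "i1 \<noteq> i0" by (auto simp: i1_def)
    obtain j1 j2 where j12: "j1 < 3" "j2 < 3" "j1 \<noteq> j0" "j2 \<noteq> j0" "j1 \<noteq> (j2 :: nat)"
      by (rule that[of "if j0 = 0 then 1 else 0" "if j0 = 2 then 1 else 2"]) auto
    \<comment> \<open>At most one of the two remaining edges at b repeats the colour of the edge
      from i1 to a; k picks one that does not.\<close>
    define k where "k = (if d j1 b = d i1 a then j2 else j1)"
    have k: "k < 3" "k \<noteq> j0" "d k b \<noteq> d i1 a"
      using j12 d_inj[of j1 j2 b] ab by (auto simp: k_def)
    have D: "distinct [d i0 a, d i1 a, d j0 b, d k b]"
      using d_inj[of i0 i1 a] d_inj[of j0 k b] ij0 i1 k ab d_in[of i0 a] d_in[of i1 a] d_in[of j0 b] d_in[of k b]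
      by auto
    \<comment> \<open>Two pairs of left vertices out of three always meet: equal pairs give a
      4-cycle, pairs with one common vertex a 6-cycle.\<close>
    consider "j0 = i0" "k = i1" | "j0 = i0" "k \<noteq> i1" | "j0 = i1" "k = i0" | "j0 = i1" "k \<noteq> i0"
      | "k = i0" "j0 \<noteq> i1" | "k = i1" "j0 \<noteq> i0"
      using ij0 i1 k by linarith
    then show ?thesis
    proof cases
      case 1 then show ?thesis using same[of a b i0 i1] ab D ij0 i1 by auto
    next
      case 2 then show ?thesis using shared[of a b i0 i1 k] ab D ij0 i1 k by auto
    next
      case 3 then show ?thesis using same[of a b i0 i1] ab D ij0 i1 by auto
    next
      case 4 then show ?thesis using shared[of a b i1 i0 k] ab D ij0 i1 k by auto
    next
      case 5 then show ?thesis using shared[of a b i0 i1 j0] ab D ij0 i1 k by auto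
    next
      case 6 then show ?thesis using shared[of a b i1 i0 j0] ab D ij0 i1 k by auto
    qed
  qed
  have "good_colouring (KV 3 n) (KE 3 n) 2 (colour_by d)"
    unfolding good_colouring_def
  proof (intro allI impI, elim conjE)
    fix S assume S: "S \<subseteq> KV 3 n" "card S = 2"
    then obtain x y where xy: "S = {x, y}" "x \<noteq> y" by (auto simp: card_2_iff)
    have n0: "0 < n" using assms(1) by simp
    have other: "\<exists>i'<3. i \<noteq> i'" for i :: nat by (rule exI[of _ "if i = 0 then 1 else 0"]) auto
    show "?good S"
    proof (cases x)
      case x: (Inl i)
      then have i: "i < 3" using S xy by (auto simp: KV_def)
      show ?thesis
      proof (cases y)
        case (Inl i')
        then show ?thesis using four[of S i i' 0] x xy S n0 by (auto simp: KV_def)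
      next
        case (Inr j)
        obtain i' where "i' < 3" "i \<noteq> i'" using other by blast
        then show ?thesis using four[of S i i' j] x xy S Inr by (auto simp: KV_def)
      qed
    next
      case x: (Inr j)
      show ?thesis
      proof (cases y)
        case (Inl i)
        obtain i' where "i' < 3" "i \<noteq> i'" using other by blast
        then show ?thesis using four[of S i i' j] x xy S Inl by (auto simp: KV_def)
      next
        case (Inr j')
        then show ?thesis using right[of j j'] x xy S by (auto simp: KV_def)
      qed
    qed
  qed
  moreover have "\<forall>i<3. \<forall>j<n. d i j < r" using d_in hr by blast
  ultimately show ?thesis by blast
qed

text \<open>Applied to even and odd right vertices: whatever the parities of the at most two
  prescribed vertices, two vertices of each parity can be chosen to include them.\<close>

lemma two_distinct_covering:
  assumes "B \<subseteq> P \<union> Q" "card B \<le> 2" "finite B"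
    and "p1 \<in> P" "p2 \<in> P" "p1 \<noteq> p2" "q1 \<in> Q" "q2 \<in> Q" "q1 \<noteq> q2"
  obtains a a' b b' where "a \<in> P" "a' \<in> P" "a \<noteq> a'" "b \<in> Q" "b' \<in> Q" "b \<noteq> b'" "B \<subseteq> {a, a', b, b'}"
proof -
  have two: "\<exists>a a'. a \<in> X \<and> a' \<in> X \<and> a \<noteq> a' \<and> B \<inter> X \<subseteq> {a, a'}"
    if "x \<in> X" "x' \<in> X" "x \<noteq> x'" for x x' X
  proof -
    have "card (B \<inter> X) \<le> 2" using card_mono[OF assms(3), of "B \<inter> X"] assms(2) by simp
    then consider "B \<inter> X = {}" | a where "B \<inter> X = {a}" | a a' where "B \<inter> X = {a, a'}" "a \<noteq> a'"
      using assms(3) card_1_singleton_iff card_2_iff card_0_eq[of "B \<inter> X"]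
      by (metis (no_types, lifting) One_nat_def finite_Int le_SucE le_zero_eq numeral_2_eq_2)
    then show ?thesis
    proof cases
      case (2 a)
      then have "a \<in> X" by auto
      then show ?thesis using 2 that by (cases "a = x") blast+
    qed (use that in blast)+
  qed
  from two[OF assms(4-6)] obtain a a' where a: "a \<in> P" "a' \<in> P" "a \<noteq> a'" "B \<inter> P \<subseteq> {a, a'}"
    by blast
  from two[OF assms(7-9)] obtain b b' where b: "b \<in> Q" "b' \<in> Q" "b \<noteq> b'" "B \<inter> Q \<subseteq> {b, b'}"
    by blast
  have "B \<subseteq> {a, a', b, b'}" using a(4) b(4) assms(1) by blast
  then show thesis by (rule that[OF a(1-3) b(1-3)])
qed

text \<open>Even right vertices see the colours \<open>0, 1, 2, 3\<close> at the first four left vertices, odd ones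
  \<open>4, 5, 6, 7\<close>. The right vertices \<open>2i\<close> and \<open>2i + 1\<close> separate the left vertex \<open>i \<ge> 4\<close> from all others.\<close>
lemma ex_good_colouring_2_8:
  assumes "4 \<le> m" "2 * m \<le> n"
  shows "\<exists>d. good_colouring (KV m n) (KE m n) 2 (colour_by d) \<and> (\<forall>i j. d i j < 8)"
proof (intro exI conjI allI)
  let ?d = "\<lambda>i j. if i < 4 then i + 4 * (j mod 2)
    else (if j div 2 = i then 0 else 1) + 2 * (j mod 2) :: nat"
  show "?d i j < 8" for i j by (auto simp: less_Suc_eq_0_disj)
  let ?good = "\<lambda>S. \<exists>vs. is_cycle (KE m n) vs \<and> S \<subseteq> set vs \<and> rainbow (colour_by ?d) vs"
  \<comment> \<open>On this 8-cycle each of the left vertices 0, 1, 2, 3 has one even and one odd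
    neighbour, so all eight colours occur once.\<close>
  have core: "?good S"
    if AB: "S = Inl ` A \<union> Inr ` B" "A \<subseteq> {..<4}" "B \<subseteq> {..<n}" "card B \<le> 2" for S A B
  proof -
    have "finite B" using AB(3) by (rule finite_subset) simp
    define P where "P = {j. j < n \<and> even j}"
    define Q where "Q = {j. j < n \<and> odd j}"
    have "B \<subseteq> P \<union> Q" using AB(3) by (auto simp: P_def Q_def)
    moreover have "0 \<in> P" "2 \<in> P" "(0::nat) \<noteq> 2" "1 \<in> Q" "3 \<in> Q" "(1::nat) \<noteq> 3"
      using assms by (simp_all add: P_def Q_def)
    ultimately obtain a a' b b' where ab: "a \<in> P" "a' \<in> P" "a \<noteq> a'"
      "b \<in> Q" "b' \<in> Q" "b \<noteq> b'" "B \<subseteq> {a, a', b, b'}"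
      using two_distinct_covering[OF _ AB(4) \<open>finite B\<close>] by metis
    have A: "A \<subseteq> {0, 1, 2, 3}" using AB(2) by (auto simp: subset_iff)
    have "a mod 2 = 0" "a' mod 2 = 0" "b mod 2 = 1" "b' mod 2 = 1"
      using ab by (auto simp: P_def Q_def even_iff_mod_2_eq_zero odd_iff_mod_2_eq_one)
    moreover have "a < n" "a' < n" "b < n" "b' < n" using ab by (auto simp: P_def Q_def)
    ultimately show ?thesis
      using ab A assms(1) AB(1)
      by (intro rainbow_cycle_lists[where xs = "[0, 1, 2, 3]" and ys = "[a, b, a', b']"]) auto
  qed
  have ww: "?good {Inl i, Inl i'}" if "4 \<le> i" "4 \<le> i'" "i < m" "i' < m" "i \<noteq> i'" for i i'
    using that assms
    by (intro rainbow_cycle_lists[where xs = "[i, i']" and ys = "[2 * i, 2 * i + 1]"]) auto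
  have xw: "?good {Inl t, Inl i}" if ti: "t < 4" "4 \<le> i" "i < m" for t i
  proof -
    \<comment> \<open>At i, the vertices 2i and 2i + 1 give colours 0 and 2. These clash with the
      even edge at t = 0 and t = 2 respectively; replacing the offending vertex by 0 or 1 changes
      its colour at i to 1 or 3.\<close>
    define a where "a = (if t = 0 then 0 else 2 * i)"
    define b where "b = (if t = 2 then 1 else 2 * i + 1)"
    have "t \<in> {0, 1, 2, 3}" using ti(1) by auto
    then consider "t = 0" | "t = 1" | "t = 2" | "t = 3" by blast
    then show ?thesis
      using ti assms
      by cases (intro rainbow_cycle_lists[where xs = "[i, t]" and ys = "[a, b]"]; auto simp: a_def b_def)+
  qed
  \<comment> \<open>An even j has colour 0 or 1 at i, so the partner 3 with colours 3 and 7 is safe;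
    an odd j has colour 2 or 3, so the partner 1 with colours 1 and 5 is.\<close>
  have wv: "?good {Inl i, Inr j}" if "4 \<le> i" "i < m" "j < n" for i j
  proof (cases "even j")
    case True
    then have "j mod 2 = 0" "j \<noteq> 2 * i + 1" by auto
    then show ?thesis
      using that assms
      by (intro rainbow_cycle_lists[where xs = "[i, 3]" and ys = "[j, 2 * i + 1]"]) auto
  next
    case False
    then have "j mod 2 = 1" "j \<noteq> 2 * i" by (auto simp: odd_iff_mod_2_eq_one)
    then show ?thesis
      using that assms
      by (intro rainbow_cycle_lists[where xs = "[i, 1]" and ys = "[j, 2 * i]"]) auto
  qed
  show "good_colouring (KV m n) (KE m n) 2 (colour_by ?d)"
    unfolding good_colouring_def
  proof (intro allI impI, elim conjE)
    fix S assume S: "S \<subseteq> KV m n" "card S = 2"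
    obtain A B where AB: "S = Inl ` A \<union> Inr ` B" "A \<subseteq> {..<m}" "B \<subseteq> {..<n}" "card A + card B = 2"
      using split_vertex_set[OF S] by blast
    show "?good S"
    proof (cases "A \<subseteq> {..<4}")
      case True
      then show ?thesis using core[OF AB(1) True AB(3)] AB(4) by simp
    next
      case False
      then obtain i where i: "i \<in> A" "4 \<le> i" "i < m" using AB(2) by (auto simp: subset_iff not_less)
      then have "Inl i \<in> S" using AB(1) by auto
      then obtain y where y: "S = {Inl i, y}" "y \<noteq> Inl i"
        using S(2) by (auto simp: card_2_iff doubleton_eq_iff)
      show ?thesis
      proof (cases y)
        case (Inl i')
        then have i': "i' < m" "i' \<noteq> i" using y S(1) by (auto simp: KV_def)
        show ?thesis
        proof (cases "i' < 4")
          case True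
          then show ?thesis using xw[OF True i(2,3)] y Inl by (simp add: insert_commute)
        next
          case False
          then show ?thesis using ww[of i i'] i i' y Inl by simp
        qed
      next
        case (Inr j)
        then have "j < n" using y S(1) by (auto simp: KV_def)
        then show ?thesis using wv[OF i(2,3)] y Inr by simp
      qed
    qed
  qed
qed

lemma less_3_times_cases:
  assumes "p < 3 * k"
  obtains s where "s < k" "p = 3 * s \<or> p = Suc (3 * s) \<or> p = Suc (Suc (3 * s))"
proof
  show "p div 3 < k" using assms by simp
  show "p = 3 * (p div 3) \<or> p = Suc (3 * (p div 3)) \<or> p = Suc (Suc (3 * (p div 3)))"
    by presburger
qed

text \<open>Vertices \<open>x\<^sub>i\<close> on the left and \<open>z\<^sub>j\<close> on the right with index below \<open>2k\<close> serve as connectors.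
  Any left vertices \<open>w\<^sub>0, \<dots>, w\<^sub>k\<^sub>-\<^sub>1\<close> and right vertices \<open>y\<^sub>0, \<dots>, y\<^sub>k\<^sub>-\<^sub>1\<close> of larger index lie on the
  rainbow cycle formed by the segments
  \<open>x\<^sub>2\<^sub>s, y\<^sub>s, x\<^sub>2\<^sub>s\<^sub>+\<^sub>1, z\<^sub>2\<^sub>s, w\<^sub>s, z\<^sub>2\<^sub>s\<^sub>+\<^sub>1\<close> for \<open>s < k\<close>, which visits all connectors.\<close>
lemma ex_good_colouring_6k:
  assumes "1 \<le> k" "3 * k \<le> m" "3 * k \<le> n"
  shows "\<exists>d. good_colouring (KV m n) (KE m n) k (colour_by d) \<and> (\<forall>i j. d i j < 6 * k)"
proof (intro exI conjI allI)
  let ?d = "\<lambda>i j. if i < 2 * k then if j < 2 * k then 4 * k + j else i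
    else if j < 2 * k then 2 * k + j else 0"
  show "?d i j < 6 * k" for i j using assms(1) by auto
  show "good_colouring (KV m n) (KE m n) k (colour_by ?d)"
    unfolding good_colouring_def
  proof (intro allI impI, elim conjE)
    fix S assume S: "S \<subseteq> KV m n" "card S = k"
    obtain A B where AB: "S = Inl ` A \<union> Inr ` B" "A \<subseteq> {..<m}" "B \<subseteq> {..<n}" "card A + card B = k"
      using split_vertex_set[OF S] by blast
    have fin: "finite A" "finite B" using AB(2,3) by (auto intro: finite_subset)
    \<comment> \<open>Prescribed vertices that are connectors are visited anyway; only the others
      have to be placed among the w and y, which are padded to k each.\<close>
    have small: "card (A - {..<2 * k}) \<le> k" "card (B - {..<2 * k}) \<le> k"
      using card_mono[OF fin(1), of "A - {..<2 * k}"] card_mono[OF fin(2), of "B - {..<2 * k}"] AB(4)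
      by auto
    have subA: "A - {..<2 * k} \<subseteq> {2 * k..<m}" and subB: "B - {..<2 * k} \<subseteq> {2 * k..<n}"
      using AB(2,3) by auto
    have large: "k \<le> card {2 * k..<m}" "k \<le> card {2 * k..<n}" using assms by simp_all
    obtain w where w: "inj_on w {..<k}" "A - {..<2 * k} \<subseteq> w ` {..<k}" "w ` {..<k} \<subseteq> {2 * k..<m}"
      by (rule enumerate_superset[OF subA small(1) large(1) finite_atLeastLessThan])
    obtain y where y: "inj_on y {..<k}" "B - {..<2 * k} \<subseteq> y ` {..<k}" "y ` {..<k} \<subseteq> {2 * k..<n}"
      by (rule enumerate_superset[OF subB small(2) large(2) finite_atLeastLessThan])
    have wy: "2 * k \<le> w s" "w s < m" "2 * k \<le> y s" "y s < n" if "s < k" for s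
      using that w(3) y(3) by auto
    have wy_inj: "w s = w s' \<longleftrightarrow> s = s'" "y s = y s' \<longleftrightarrow> s = s'" if "s < k" "s' < k" for s s'
      using that w(1) y(1) by (auto simp: inj_on_def)
    define f where "f p = (if p mod 3 = 0 then 2 * (p div 3)
      else if p mod 3 = 1 then 2 * (p div 3) + 1 else w (p div 3))" for p
    define g where "g p = (if p mod 3 = 0 then y (p div 3)
      else if p mod 3 = 1 then 2 * (p div 3) else 2 * (p div 3) + 1)" for p
    have div_mod: "Suc (Suc (3 * s)) div 3 = s" "Suc (Suc (3 * s)) mod 3 = 2" for s by presburger+
    have f: "f (3 * s) = 2 * s" "f (Suc (3 * s)) = 2 * s + 1" "f (Suc (Suc (3 * s))) = w s" for s
      by (simp_all add: f_def div_mod)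
    have g: "g (3 * s) = y s" "g (Suc (3 * s)) = 2 * s" "g (Suc (Suc (3 * s))) = 2 * s + 1" for s
      by (simp_all add: g_def div_mod)
    \<comment> \<open>At the end of a segment the exact next connector does not matter, as edges
      between connectors are coloured by their right end.\<close>
    have next_f: "f (Suc (3 * s) mod (3 * k)) = 2 * s + 1" "f (Suc (Suc (3 * s)) mod (3 * k)) = w s"
      "f (Suc (Suc (Suc (3 * s))) mod (3 * k)) < 2 * k" if "s < k" for s
    proof -
      show "f (Suc (3 * s) mod (3 * k)) = 2 * s + 1" "f (Suc (Suc (3 * s)) mod (3 * k)) = w s"
        using that by (simp_all add: f)
      have "Suc (Suc (Suc (3 * s))) mod (3 * k) = (3 * Suc s) mod (3 * k)"
        by (simp add: eval_nat_numeral)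
      also have "\<dots> = 3 * (Suc s mod k)" by (rule mult_mod_right[symmetric])
      finally show "f (Suc (Suc (Suc (3 * s))) mod (3 * k)) < 2 * k"
        using that by (simp add: f)
    qed
    let ?u = "\<lambda>p. ?d (f p) (g p)" and ?v = "\<lambda>p. ?d (f (Suc p mod (3 * k))) (g p)"
    have u: "?u (3 * s) = 2 * s" "?u (Suc (3 * s)) = 4 * k + 2 * s"
      "?u (Suc (Suc (3 * s))) = 2 * k + 2 * s + 1" if "s < k" for s
      using that wy[OF that] by (simp_all add: f g)
    have v: "?v (3 * s) = 2 * s + 1" "?v (Suc (3 * s)) = 2 * k + 2 * s"
      "?v (Suc (Suc (3 * s))) = 4 * k + 2 * s + 1" if "s < k" for s
      using that wy[OF that] next_f[OF that] by (simp_all add: g)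
    have inj_f: "inj_on f {..<3 * k}"
    proof (rule inj_onI)
      fix p p' assume pp: "p \<in> {..<3 * k}" "p' \<in> {..<3 * k}" and eq: "f p = f p'"
      obtain s where s: "s < k" "p = 3 * s \<or> p = Suc (3 * s) \<or> p = Suc (Suc (3 * s))"
        using pp(1) less_3_times_cases by auto
      obtain s' where s': "s' < k" "p' = 3 * s' \<or> p' = Suc (3 * s') \<or> p' = Suc (Suc (3 * s'))"
        using pp(2) less_3_times_cases by auto
      show "p = p'"
        using s(2) s'(2) eq s(1) s'(1) wy(1)[OF s(1)] wy(1)[OF s'(1)] wy_inj(1)[OF s(1) s'(1)]
        by (elim disjE; simp add: f; presburger)
    qed
    have inj_g: "inj_on g {..<3 * k}"
    proof (rule inj_onI)
      fix p p' assume pp: "p \<in> {..<3 * k}" "p' \<in> {..<3 * k}" and eq: "g p = g p'"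
      obtain s where s: "s < k" "p = 3 * s \<or> p = Suc (3 * s) \<or> p = Suc (Suc (3 * s))"
        using pp(1) less_3_times_cases by auto
      obtain s' where s': "s' < k" "p' = 3 * s' \<or> p' = Suc (3 * s') \<or> p' = Suc (Suc (3 * s'))"
        using pp(2) less_3_times_cases by auto
      show "p = p'"
        using s(2) s'(2) eq s(1) s'(1) wy(3)[OF s(1)] wy(3)[OF s'(1)] wy_inj(2)[OF s(1) s'(1)]
        by (elim disjE; simp add: g; presburger)
    qed
    have fm: "f ` {..<3 * k} \<subseteq> {..<m}" and gn: "g ` {..<3 * k} \<subseteq> {..<n}"
      using assms wy by (auto elim!: less_3_times_cases simp: f g; fastforce)+
    have "rainbow (colour_by ?d) (alt_cycle (3 * k) f g)"
    proof (rule rainbow_alt_cycle)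
      show "inj_on ?u {..<3 * k}"
      proof (rule inj_onI)
        fix p p' assume pp: "p \<in> {..<3 * k}" "p' \<in> {..<3 * k}" and eq: "?u p = ?u p'"
        obtain s where s: "s < k" "p = 3 * s \<or> p = Suc (3 * s) \<or> p = Suc (Suc (3 * s))"
          using pp(1) less_3_times_cases by auto
        obtain s' where s': "s' < k" "p' = 3 * s' \<or> p' = Suc (3 * s') \<or> p' = Suc (Suc (3 * s'))"
          using pp(2) less_3_times_cases by auto
        show "p = p'"
          using s(2) s'(2) eq s(1) s'(1)
          by (elim disjE; simp only: u; linarith)
      qed
      show "inj_on ?v {..<3 * k}"
      proof (rule inj_onI)
        fix p p' assume pp: "p \<in> {..<3 * k}" "p' \<in> {..<3 * k}" and eq: "?v p = ?v p'"
        obtain s where s: "s < k" "p = 3 * s \<or> p = Suc (3 * s) \<or> p = Suc (Suc (3 * s))"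
          using pp(1) less_3_times_cases by auto
        obtain s' where s': "s' < k" "p' = 3 * s' \<or> p' = Suc (3 * s') \<or> p' = Suc (Suc (3 * s'))"
          using pp(2) less_3_times_cases by auto
        show "p = p'"
          using s(2) s'(2) eq s(1) s'(1)
          by (elim disjE; simp only: v; linarith)
      qed
      have u_neq_v: "?u p \<noteq> ?v p'" if pp: "p < 3 * k" "p' < 3 * k" for p p'
      proof -
        obtain s where s: "s < k" "p = 3 * s \<or> p = Suc (3 * s) \<or> p = Suc (Suc (3 * s))"
          using pp(1) less_3_times_cases by auto
        obtain s' where s': "s' < k" "p' = 3 * s' \<or> p' = Suc (3 * s') \<or> p' = Suc (Suc (3 * s'))"
          using pp(2) less_3_times_cases by auto
        show ?thesis
          using s(2) s'(2) s(1) s'(1)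
          by (elim disjE; simp only: u v; presburger)
      qed
      show "?u ` {..<3 * k} \<inter> ?v ` {..<3 * k} = {}"
      proof (intro equals0I, elim IntE imageE)
        fix x p p' assume pp: "x = ?u p" "p \<in> {..<3 * k}" "x = ?v p'" "p' \<in> {..<3 * k}"
        then have "?u p \<noteq> ?v p'" by (intro u_neq_v) (simp_all only: lessThan_iff)
        then show False using trans[OF pp(1)[symmetric] pp(3)] by (rule notE)
      qed
    qed
    moreover have "is_cycle (KE m n) (alt_cycle (3 * k) f g)"
      using assms(1) inj_f inj_g fm gn by (intro is_cycle_alt_cycle) auto
    moreover have "S \<subseteq> set (alt_cycle (3 * k) f g)"
    proof -
      have connector: "i \<in> f ` {..<3 * k}" "i \<in> g ` {..<3 * k}" if i: "i < 2 * k" for i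
      proof -
        have "i div 2 < k" "i = 2 * (i div 2) \<or> i = 2 * (i div 2) + 1" using i by auto
        then obtain s where s: "s < k" "i = 2 * s \<or> i = 2 * s + 1" by blast
        then show "i \<in> f ` {..<3 * k}"
          using f(1,2)[of s] by (auto intro: image_eqI[of _ f "3 * s"] image_eqI[of _ f "Suc (3 * s)"])
        show "i \<in> g ` {..<3 * k}"
          using s g(2,3)[of s] by (auto intro: image_eqI[of _ g "Suc (3 * s)"] image_eqI[of _ g "Suc (Suc (3 * s))"])
      qed
      have "w s \<in> f ` {..<3 * k}" "y s \<in> g ` {..<3 * k}" if "s < k" for s
        using f(3)[of s] g(1)[of s] that
        by (auto intro: image_eqI[of _ f "Suc (Suc (3 * s))"] image_eqI[of _ g "3 * s"])
      then have "A \<subseteq> f ` {..<3 * k}" "B \<subseteq> g ` {..<3 * k}"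
        using w(2) y(2) connector by blast+
      then show ?thesis unfolding set_alt_cycle AB(1) by (intro Un_mono image_mono)
    qed
    ultimately show "\<exists>vs. is_cycle (KE m n) vs \<and> S \<subseteq> set vs \<and> rainbow (colour_by ?d) vs"
      by (intro exI[of _ "alt_cycle (3 * k) f g"] conjI)
  qed
qed

section \<open>The cube root estimate\<close>

lemma six_times_choose_3: "6 * (n + 3 choose 3) = (n + 1) * (n + 2) * (n + 3)"
proof -
  have "(n + 3) * (n + 2 choose 2) = (n + 3 choose 3) * 3"
    using Suc_times_binomial_eq[of "n + 2" 2] by (simp add: eval_nat_numeral)
  moreover have "(n + 2) * (n + 1) = (n + 2 choose 2) * 2"
    using Suc_times_binomial_eq[of "n + 1" 1] by (simp add: eval_nat_numeral)
  ultimately have "(n + 3) * ((n + 2) * (n + 1)) = (n + 3 choose 3) * 6" by (metis mult.assoc num_double numeral_times_numeral mult.left_commute mult.commute)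
  then show ?thesis by (simp add: mult_ac)
qed

text \<open>With x = r - 1, the hypotheses read (x-2)(x-1)x < 6n <= (x-1)x(x+1). The left product
  exceeds (x-2)^3 and the right one is x^3 - x < x^3, so the cube root of 6n lies strictly between r
  - 3 and r - 1.\<close>

lemma choose_3_root_bounds:
  assumes "8 \<le> r" "(r - 1) choose 3 < n" "n \<le> r choose 3"
  shows "1 < real r - root 3 (6 * real n)" "real r - root 3 (6 * real n) < 3"
proof -
  obtain t where t: "r = t + 4" using assms(1) by (metis add.commute le_Suc_ex numeral_Bit0 add.assoc)
  have 1: "6 * n \<le> (t + 2) * (t + 3) * (t + 4)"
    using assms(3) six_times_choose_3[of "t + 1"] t by (simp add: algebra_simps)
  have 2: "(t + 1) * (t + 2) * (t + 3) < 6 * n"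
    using assms(2) six_times_choose_3[of t] t by (simp add: algebra_simps)
  have "6 * n < (t + 3) ^ 3" using 1 by (simp add: power3_eq_cube algebra_simps)
  then have "real (6 * n) < real ((t + 3) ^ 3)" by (simp only: of_nat_less_iff)
  then have "root 3 (6 * real n) < root 3 (real (t + 3) ^ 3)"
    by (intro real_root_less_mono) simp_all
  moreover have "(t + 1) ^ 3 < 6 * n" using 2 by (simp add: power3_eq_cube algebra_simps)
  then have "real ((t + 1) ^ 3) < real (6 * n)" by (simp only: of_nat_less_iff)
  then have "root 3 (real (t + 1) ^ 3) < root 3 (6 * real n)"
    by (intro real_root_less_mono) simp_all
  ultimately show "1 < real r - root 3 (6 * real n)" "real r - root 3 (6 * real n) < 3"
    using t by (simp_all add: real_root_power_cancel)
qed

section \<open>Exact values and bounds for complete bipartite graphs\<close>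

lemma crxK_1_eq: "crxK 1 m n = 4" if mn: "2 \<le> m" "2 \<le> n"
proof -
  obtain d where d: "good_colouring (KV m n) (KE m n) 1 (colour_by d)" "\<forall>i j. d i j < 4"
    using ex_good_colouring_1_4 mn by blast
  have "4 \<le> crxK 1 m n" by (rule crx_ge[OF d(1)]) (rule card_colours_1_ge, use mn in auto)
  then show ?thesis using crxK_le_colour_by[OF d(1), of 4] d(2) by simp
qed

lemma crxK_2_2_eq: "crxK 2 2 n = 2 * n" if n: "2 \<le> n"
proof (rule antisym)
  show "crxK 2 2 n \<le> 2 * n" using crxK_le_mult[of 2 2 n] n by simp
  show "2 * n \<le> crxK 2 2 n"
    using good_colouring_distinct_colours[of 2 2 n] card_colours_2_2_ge n by (intro crx_ge) auto
qed

lemma crxK_2_3_eq: "crxK 2 3 n = r"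
  if nr: "36 \<le> n" "(r - 1) choose 3 < n" "n \<le> r choose 3" "8 \<le> r"
proof (rule antisym)
  obtain d where d: "good_colouring (KV 3 n) (KE 3 n) 2 (colour_by d)" "\<forall>i<3. \<forall>j<n. d i j < r"
    using ex_good_colouring_2_3[of n r] nr by auto
  show "crxK 2 3 n \<le> r" using crxK_le_colour_by[OF d(1)] d(2) by blast
  show "r \<le> crxK 2 3 n"
  proof (rule crx_ge[OF d(1)], rule ccontr)
    fix c assume c: "good_colouring (KV 3 n) (KE 3 n) 2 c" and "\<not> r \<le> card (c ` KE 3 n)"
    then have "card (c ` KE 3 n) choose 3 \<le> (r - 1) choose 3" by (intro binomial_right_mono) simp
    then show False using card_colours_2_3_choose_3_ge[OF c] nr by simp
  qed
qed

lemma crxK_ge_4k: "4 * k \<le> crxK k m n"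
  if k: "2 \<le> k" "k \<le> m" "(k - 1) * (4 * k - 1) ^ m < n"
proof -
  \<comment> \<open>The size hypothesis implies k <= n, which the colouring witnessing existence
    requires.\<close>
  have "k \<le> 4 * k - 1" using k(1) by simp
  also have "\<dots> \<le> (4 * k - 1) ^ m" using k(1,2) by (intro self_le_power) auto
  also have "\<dots> \<le> (k - 1) * (4 * k - 1) ^ m" using k(1) by simp
  finally have "k \<le> n" using k(3) by simp
  then show ?thesis
    using good_colouring_distinct_colours[OF k(1,2)] card_colours_ge_4k[OF _ _ k(3)] k(1) by (intro crx_ge) auto
qed

lemma crxK_2_eq_8: "crxK 2 m n = 8" if mn: "4 \<le> m" "7 ^ m < n"
proof (rule antisym)
  \<comment> \<open>This leaves room for the right vertices 2i and 2i + 1 for every left vertex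
    i.\<close>
  have "2 * m + 1 \<le> 7 ^ m" by (induction m) auto
  then obtain d where d: "good_colouring (KV m n) (KE m n) 2 (colour_by d)" "\<forall>i j. d i j < 8"
    using ex_good_colouring_2_8[of m n] mn by auto
  show "crxK 2 m n \<le> 8" using crxK_le_colour_by[OF d(1)] d(2) by blast
  show "8 \<le> crxK 2 m n" using crxK_ge_4k[of 2 m n] mn by simp
qed

lemma ceiling_le_crxK: "\<lceil>real n / real (k - 1)\<rceil> \<le> int (crxK k k n)" if kn: "2 \<le> k" "k \<le> n"
proof -
  have "real n / real (k - 1) \<le> real s" if "n \<le> (k - 1) * s" for s
  proof -
    have "real n \<le> real ((k - 1) * s)" using that by (simp only: of_nat_le_iff)
    then show ?thesis using kn(1) by (simp add: divide_le_eq mult.commute)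
  qed
  moreover have "nat \<lceil>real n / real (k - 1)\<rceil> \<le> crxK k k n"
    by (rule crx_ge[OF good_colouring_distinct_colours[OF kn(1) order.refl kn(2)]])
      (use card_colours_k_k_ge kn calculation in \<open>simp add: ceiling_le_iff nat_le_iff\<close>)
  ultimately show ?thesis by (simp add: nat_le_iff)
qed

theorem theorem3p3:
  shows
  "(\<forall>m n. 2 \<le> m \<and> m \<le> n \<longrightarrow> crxK 1 m n = 4)
   \<and> (\<forall>n. 2 \<le> n \<longrightarrow> crxK 2 2 n = 2 * n)
   \<and> (\<forall>n r. 36 \<le> n \<and> (r - 1) choose 3 < n \<and> n \<le> r choose 3 \<longrightarrow>
          crxK 2 3 n = r \<and>
          1 < real (crxK 2 3 n) - root 3 (6 * real n) \<and>
          real (crxK 2 3 n) - root 3 (6 * real n) < 3)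
   \<and> (\<forall>m n. 4 \<le> m \<and> 7 ^ m < n \<longrightarrow> crxK 2 m n = 8)
   \<and> (\<forall>k. 2 \<le> k \<longrightarrow>
        (\<forall>n. k \<le> n \<longrightarrow>
           real_of_int \<lceil>real n / real (k - 1)\<rceil> \<le> real (crxK k k n) \<and> crxK k k n \<le> k * n)
      \<and> (\<forall>m n. 2 * k \<le> m \<and> (k - 1) * (4 * k - 1) ^ m < n \<longrightarrow> 4 * k \<le> crxK k m n)
      \<and> (\<forall>m n. 3 * k \<le> m \<and> m \<le> n \<longrightarrow> crxK k m n \<le> 6 * k))"
proof (intro conjI allI impI; (elim conjE)?)
  show "crxK 1 m n = 4" if "2 \<le> m" "m \<le> n" for m n using crxK_1_eq that by simp
  show "crxK 2 2 n = 2 * n" if "2 \<le> n" for n using crxK_2_2_eq that .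
  show "crxK 2 m n = 8" if "4 \<le> m" "7 ^ m < n" for m n using crxK_2_eq_8 that .
  fix n r :: nat assume nr: "36 \<le> n" "(r - 1) choose 3 < n" "n \<le> r choose 3"
  \<comment> \<open>Otherwise n would be at most (7 choose 3) = 35.\<close>
  have "8 \<le> r"
  proof (rule ccontr)
    assume "\<not> 8 \<le> r"
    then have "r choose 3 \<le> 7 choose 3" by (intro binomial_right_mono) simp
    then show False using nr(1,3) by (simp add: numeral_eq_Suc)
  qed
  then show "crxK 2 3 n = r" "1 < real (crxK 2 3 n) - root 3 (6 * real n)"
    "real (crxK 2 3 n) - root 3 (6 * real n) < 3"
    using crxK_2_3_eq[OF nr] choose_3_root_bounds nr by simp_all
next
  fix k :: nat assume k: "2 \<le> k"
  show "real_of_int \<lceil>real n / real (k - 1)\<rceil> \<le> real (crxK k k n)" if "k \<le> n" for n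
    using ceiling_le_crxK[OF k that] by (metis of_int_le_iff of_int_of_nat_eq)
  show "crxK k k n \<le> k * n" if "k \<le> n" for n using crxK_le_mult[OF k order.refl that] .
  show "4 * k \<le> crxK k m n" if "2 * k \<le> m" "(k - 1) * (4 * k - 1) ^ m < n" for m n
    using crxK_ge_4k[OF k] that by simp
  show "crxK k m n \<le> 6 * k" if mn: "3 * k \<le> m" "m \<le> n" for m n
  proof -
    obtain d where d: "good_colouring (KV m n) (KE m n) k (colour_by d)" "\<forall>i j. d i j < 6 * k"
      using ex_good_colouring_6k[of k m n] k mn by auto
    then show ?thesis using crxK_le_colour_by[OF d(1)] by blast
  qed
qed

end
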